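(* Fix a known initial distance $d\ge1$ and let $\mathcal{A}$ be the zigzag strategy with $u_i=2^{3\cdot 2^i\sqrt{i+1}-1}$ for $i\ge0$; explicitly, starting with $t=0$, for $i=0,1,2,\dots$ the robot sets $v_i=1-u_i^{-1}$, $x_i=u_i(d+v_it)$, moves at speed $1$ from the origin to position $(-1)^ix_i$ and back to the origin, and updates $t\leftarrow t+2x_i$. Then $CR_{\mathcal{A}}(u)=9$ for all $1\le u\le4$, and $CR_{\mathcal{A}}(u)\le 56.18\,u^{4-(\log_2\log_2 u)^{-2}}$ for all $u>4$.
   Context: Search model: a robot starts at the origin of the real line at time $0$ with maximum speed $1$. A target starts at distance $d\ge1$ from the origin on one of the two sides (unknown to the searcher) and moves away from the origin at constant speed $v\in[0,1)$, unknown to the searcher; $d$ is known. The evasiveness is $u=\frac1{1-v}\in[1,\infty)$, $v=1-\frac1u$. For a strategy (robot position function) $\mathcal{A}:[0,\infty)\to\mathbb{R}$ and $\sigma\in\{0,1\}$, $T^\sigma_{\mathcal{A}}(u)=\inf\{t\ge0:\mathcal{A}(t)=(-1)^\sigma(d+(1-\frac1u)t)\}$, $CR^\sigma_{\mathcal{A}}(u)=T^\sigma_{\mathcal{A}}(u)/(ud)$ and $CR_{\mathcal{A}}(u)=\max(CR^0_{\mathcal{A}}(u),CR^1_{\mathcal{A}}(u))$. *)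

theory Defs
  imports "HOL-Analysis.Analysis"
begin

definition speed :: "real \<Rightarrow> real" where
  "speed u = 1 - 1 / u"

text \<open>Times are extended reals: a target that is never caught has catching time
  \<open>\<infinity>\<close>, the infimum of the empty set.\<close>

definition catch_time :: "real \<Rightarrow> (real \<Rightarrow> real) \<Rightarrow> nat \<Rightarrow> real \<Rightarrow> ereal" where
  "catch_time d A \<sigma> u =
     Inf (ereal ` {t. t \<ge> 0 \<and> A t = (-1) ^ \<sigma> * (d + speed u * t)})"

definition CR_side :: "real \<Rightarrow> (real \<Rightarrow> real) \<Rightarrow> nat \<Rightarrow> real \<Rightarrow> ereal" where
  "CR_side d A \<sigma> u = catch_time d A \<sigma> u / ereal (u * d)"

definition CR :: "real \<Rightarrow> (real \<Rightarrow> real) \<Rightarrow> real \<Rightarrow> ereal" where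
  "CR d A u = max (CR_side d A 0 u) (CR_side d A 1 u)"

text \<open>A zigzag strategy is given by a sequence \<open>us\<close> of evasiveness values. Round $i$
  starts at the origin at time \<open>round_start d us i\<close> and turns around at distance
  \<open>turn_point d us i\<close> from it.\<close>

definition turn_dist :: "real \<Rightarrow> real \<Rightarrow> real \<Rightarrow> real" where
  "turn_dist d u t = u * (d + speed u * t)"

primrec round_start :: "real \<Rightarrow> (nat \<Rightarrow> real) \<Rightarrow> nat \<Rightarrow> real" where
  "round_start d us 0 = 0"
| "round_start d us (Suc i) =
     round_start d us i + 2 * turn_dist d (us i) (round_start d us i)"

definition turn_point :: "real \<Rightarrow> (nat \<Rightarrow> real) \<Rightarrow> nat \<Rightarrow> real" where
  "turn_point d us i = turn_dist d (us i) (round_start d us i)"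

text \<open>The round in progress at time \<open>t\<close> is the first one that ends after \<open>t\<close>. It exists
  for \<open>t \<ge> 0\<close> when $d \ge 1$ and all $u_i \ge 1$, since every round then takes time at
  least 2.\<close>

definition current_round :: "real \<Rightarrow> (nat \<Rightarrow> real) \<Rightarrow> real \<Rightarrow> nat" where
  "current_round d us t = (LEAST i. t < round_start d us (Suc i))"

definition zigzag :: "real \<Rightarrow> (nat \<Rightarrow> real) \<Rightarrow> real \<Rightarrow> real" where
  "zigzag d us t =
     (let i = current_round d us t; s = round_start d us i; x = turn_point d us i
      in (-1) ^ i * (if t \<le> s + x then t - s else s + 2 * x - t))"

definition u_seq :: "nat \<Rightarrow> real" where
  "u_seq i = 2 powr (3 * 2 ^ i * sqrt (real i + 1) - 1)"

end

theory Submission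
  imports Defs
begin

text \<open>A target of evasiveness \<open>u \<le> u\<^sub>i\<close> on the side visited in round \<open>i\<close> is met on the way out,
  at time \<open>u (d + s\<^sub>i)\<close>, where \<open>s\<^sub>i\<close> is the start of the round. For \<open>u \<le> 4 = u\<^sub>0\<close> the worse side is
  reached in round 1, with \<open>s\<^sub>1 = 8 d\<close>. For \<open>u\<^bsub>i-1\<^esub> < u \<le> u\<^sub>i\<close> the ratio is at most
  \<open>1 + s\<^bsub>i+1\<^esub> / d \<le> 9 \<Prod>\<^bsub>1\<le>j\<le>i\<^esub> 2 u\<^sub>j\<close>, and since the claimed bound increases with \<open>u\<close> it remains to
  compare logarithms at \<open>u = u\<^bsub>i-1\<^esub>\<close>. With \<open>L = log\<^sub>2 u\<^bsub>i-1\<^esub>\<close> the difference between the logarithm of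
  the product and \<open>4 L\<close> changes from \<open>i\<close> to \<open>i+1\<close> by
  \<open>-6\<cdot>2\<^sup>i\<close> times \<open>2\<surd>(i+1) - \<surd>i - \<surd>(i+2) \<ge> (i+1)\<^bsup>-3/2\<^esup>/4\<close>. This dominates the growth of
  \<open>(3/2) 2\<^sup>i i\<^bsup>-3/2\<^esup>\<close>, which in turn bounds \<open>L / (log\<^sub>2 L)\<^sup>2\<close> because \<open>L \<ge> 2\<^sup>i\<close>.\<close>

section \<open>Zigzag strategies\<close>

lemma speed_nonneg: "u \<ge> 1 \<Longrightarrow> speed u \<ge> 0"
  by (simp add: speed_def)

locale zigzag_strategy =
  fixes d :: real and us :: "nat \<Rightarrow> real"
  assumes d_pos: "d > 0" and us_ge_1: "us i \<ge> 1"
begin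

lemma us_nonzero: "us i \<noteq> 0"
  using us_ge_1[of i] by simp

text \<open>Since \<open>us i * speed (us i) = us i - 1\<close>, the recursion is affine in the
  start time.\<close>

lemma round_start_Suc:
  "round_start d us (Suc i) = (2 * us i - 1) * round_start d us i + 2 * us i * d"
  using us_nonzero[of i] by (simp add: turn_dist_def speed_def field_simps)

text \<open>The robot turns exactly when it would meet a target with \<open>u = us i\<close>: the
  equation \<open>t - s = d + speed u * t\<close> has the solution
  \<open>u * (d + s)\<close>.\<close>

lemma turn_time: "round_start d us i + turn_point d us i = us i * (d + round_start d us i)"
  using us_nonzero[of i] by (simp add: turn_point_def turn_dist_def speed_def field_simps)

lemma round_start_nonneg: "round_start d us i \<ge> 0"
proof (induction i)
  case (Suc i)
  have "0 \<le> (2 * us i - 1) * round_start d us i + 2 * us i * d"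
    using Suc us_ge_1[of i] d_pos by simp
  then show ?case
    by (simp only: round_start_Suc)
qed simp

lemma turn_point_pos: "turn_point d us i > 0"
  using us_ge_1[of i] d_pos round_start_nonneg[of i] speed_nonneg[OF us_ge_1[of i]]
  by (simp add: turn_point_def turn_dist_def add_pos_nonneg)

lemma round_start_Suc_turn_point:
  "round_start d us (Suc i) = round_start d us i + 2 * turn_point d us i"
  by (simp add: turn_point_def)

lemma round_start_mono: "i \<le> j \<Longrightarrow> round_start d us i \<le> round_start d us j"
proof (rule lift_Suc_mono_le[of "round_start d us"])
  show "round_start d us n \<le> round_start d us (Suc n)" for n
    using turn_point_pos[of n] by (simp only: round_start_Suc_turn_point)
qed

lemma current_round_eq:
  assumes "round_start d us i \<le> t" "t < round_start d us (Suc i)"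
  shows "current_round d us t = i"
  unfolding current_round_def
proof (rule Least_equality)
  fix j assume "t < round_start d us (Suc j)"
  then show "i \<le> j"
    using assms(1) round_start_mono[of "Suc j" i] by (meson not_less_eq_eq not_le order.trans)
qed (fact assms(2))

lemma zigzag_outbound:
  assumes "round_start d us i \<le> t" "t \<le> round_start d us i + turn_point d us i"
  shows "zigzag d us t = (-1) ^ i * (t - round_start d us i)"
proof -
  have "t < round_start d us (Suc i)"
    using assms turn_point_pos[of i] by (simp only: round_start_Suc_turn_point)
  then show ?thesis
    using assms current_round_eq by (simp add: zigzag_def Let_def)
qed

text \<open>Rules out that a target on the negative side is met before round 1.\<close>

lemma zigzag_round_0_nonneg:
  assumes "0 \<le> t" "t < round_start d us 1"
  shows "zigzag d us t \<ge> 0"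
proof -
  have "current_round d us t = 0"
    using assms by (intro current_round_eq) auto
  moreover have "t < 2 * turn_point d us 0"
    using assms round_start_Suc_turn_point[of 0] by simp
  ultimately show ?thesis
    using assms by (simp add: zigzag_def Let_def)
qed

section \<open>Catching times and competitive ratios of zigzag strategies\<close>

lemma catch_time_le:
  assumes "1 \<le> u" "u \<le> us i" "even i \<longleftrightarrow> even \<sigma>"
  shows "catch_time d (zigzag d us) \<sigma> u \<le> ereal (u * (d + round_start d us i))"
proof -
  define s t where "s = round_start d us i" and "t = u * (d + s)"
  have s: "s \<ge> 0"
    by (simp add: s_def round_start_nonneg)
  have "1 * (d + s) \<le> t" "t \<le> us i * (d + s)"
    using assms s d_pos unfolding t_def by (intro mult_right_mono; simp)+
  then have t: "s \<le> t" "t \<le> s + turn_point d us i"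
    using d_pos turn_time[of i] by (simp_all add: s_def)
  have "t - s = d + speed u * t"
    using assms by (simp add: t_def speed_def field_simps)
  moreover have "(-1) ^ i = ((-1) ^ \<sigma> :: real)"
    using assms(3) by (simp add: minus_one_power_iff)
  ultimately have "zigzag d us t = (-1) ^ \<sigma> * (d + speed u * t)"
    using zigzag_outbound[of i t] t by (simp add: s_def)
  then show ?thesis
    using t s unfolding catch_time_def by (intro Inf_lower) (auto simp: t_def s_def)
qed

lemma CR_side_le:
  assumes "1 \<le> u" "u \<le> us i" "even i \<longleftrightarrow> even \<sigma>"
  shows "CR_side d (zigzag d us) \<sigma> u \<le> ereal (1 + round_start d us i / d)"
proof -
  have "CR_side d (zigzag d us) \<sigma> u \<le> ereal (u * (d + round_start d us i)) / ereal (u * d)"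
    unfolding CR_side_def using catch_time_le[OF assms] assms d_pos
    by (intro ereal_divide_right_mono) auto
  also have "\<dots> = ereal (1 + round_start d us i / d)"
    using assms d_pos by (simp add: field_simps)
  finally show ?thesis .
qed

text \<open>Rounds \<open>i\<close> and \<open>Suc i\<close> go to opposite sides, so each side is
  served by one of them; the later start gives the larger bound.\<close>

lemma CR_le:
  assumes "1 \<le> u" "u \<le> us i" "u \<le> us (Suc i)"
  shows "CR d (zigzag d us) u \<le> ereal (1 + round_start d us (Suc i) / d)"
proof -
  have mono: "ereal (1 + round_start d us i / d) \<le> ereal (1 + round_start d us (Suc i) / d)"
    using d_pos round_start_mono[of i "Suc i"] by (simp add: divide_right_mono del: round_start.simps)
  have "CR_side d (zigzag d us) \<sigma> u \<le> ereal (1 + round_start d us (Suc i) / d)" for \<sigma>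
  proof (cases "even i \<longleftrightarrow> even \<sigma>")
    case True
    then show ?thesis
      using CR_side_le[of u i \<sigma>] assms mono by (meson order.trans)
  next
    case False
    then show ?thesis
      using CR_side_le[of u "Suc i" \<sigma>] assms by simp
  qed
  then show ?thesis
    by (simp add: CR_def)
qed

lemma CR_eq_first_rounds:
  assumes "1 \<le> u" "u \<le> us 0" "u \<le> us 1"
  shows "CR d (zigzag d us) u = ereal (1 + 2 * us 0)"
proof (rule antisym)
  have s1: "round_start d us 1 = 2 * us 0 * d"
    using round_start_Suc[of 0] by simp
  then have s1_ratio: "round_start d us 1 / d = 2 * us 0"
    using d_pos by simp
  then show "CR d (zigzag d us) u \<le> ereal (1 + 2 * us 0)"
    using CR_le[of u 0] assms by simp
  have "ereal (u * (d + round_start d us 1)) \<le> catch_time d (zigzag d us) 1 u"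
    unfolding catch_time_def
  proof (rule Inf_greatest, clarify)
    fix t :: real
    assume t: "0 \<le> t" and catch: "zigzag d us t = (-1) ^ 1 * (d + speed u * t)"
    have "0 \<le> speed u * t"
      using t speed_nonneg[OF assms(1)] by simp
    then have "zigzag d us t < 0"
      using catch d_pos by simp
    then have ge: "round_start d us 1 \<le> t"
      using t zigzag_round_0_nonneg by (meson not_le)
    show "ereal (u * (d + round_start d us 1)) \<le> ereal t"
    proof (rule ccontr)
      \<comment> \<open>As \<open>u \<le> us 1\<close>, an earlier meeting would lie on the outbound
        leg of round 1, where the claimed time is the only root of the meeting equation.\<close>
      assume "\<not> ?thesis"
      then have lt: "t < u * (d + round_start d us 1)"
        by simp
      also have "\<dots> \<le> us 1 * (d + round_start d us 1)"
        using assms d_pos round_start_nonneg[of 1] by (intro mult_right_mono) auto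
      also have "\<dots> = round_start d us 1 + turn_point d us 1"
        by (rule turn_time[symmetric])
      finally have "zigzag d us t = - (t - round_start d us 1)"
        using zigzag_outbound[OF ge] by simp
      then have "t - round_start d us 1 = d + speed u * t"
        using catch by simp
      then have "t = u * (d + round_start d us 1)"
        using assms by (simp add: speed_def field_simps)
      then show False
        using lt by simp
    qed
  qed
  then have "ereal (u * (d + round_start d us 1)) / ereal (u * d) \<le> CR_side d (zigzag d us) 1 u"
    unfolding CR_side_def using assms d_pos by (intro ereal_divide_right_mono) auto
  moreover have "u * (d + round_start d us 1) / (u * d) = 1 + 2 * us 0"
    unfolding s1 using assms d_pos by (simp add: field_simps)
  ultimately have "ereal (1 + 2 * us 0) \<le> CR_side d (zigzag d us) 1 u"
    using assms d_pos by simp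
  then show "ereal (1 + 2 * us 0) \<le> CR d (zigzag d us) u"
    by (simp add: CR_def le_max_iff_disj)
qed

text \<open>For \<open>r = 1 + s / d\<close> the recurrence reads
  \<open>r' = (2 * u - 1) * r + 2\<close>, and \<open>r \<ge> 2\<close> absorbs the summand
  2.\<close>

lemma round_start_ratio_le:
  "1 + round_start d us (Suc i) / d \<le> (1 + 2 * us 0) * (\<Prod>j=1..i. 2 * us j)"
proof (induction i)
  case 0
  then show ?case
    using d_pos us_nonzero[of 0] round_start_Suc[of 0] by simp
next
  case (Suc i)
  define r where "r = 1 + round_start d us (Suc i) / d"
  have "2 * d \<le> 2 * us 0 * d"
    using d_pos us_ge_1[of 0] by simp
  also have "\<dots> = round_start d us 1"
    using round_start_Suc[of 0] by simp
  also have "\<dots> \<le> round_start d us (Suc i)"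
    by (intro round_start_mono) simp
  finally have "r \<ge> 2"
    using d_pos by (simp add: r_def field_simps del: round_start.simps)
  have "1 + round_start d us (Suc (Suc i)) / d = (2 * us (Suc i) - 1) * r + 2"
    using d_pos by (simp add: round_start_Suc[of "Suc i"] r_def field_simps
        del: round_start.simps)
  also have "\<dots> \<le> 2 * us (Suc i) * r"
    using \<open>r \<ge> 2\<close> by (simp add: algebra_simps)
  also have "\<dots> \<le> 2 * us (Suc i) * ((1 + 2 * us 0) * (\<Prod>j=1..i. 2 * us j))"
    using Suc us_ge_1[of "Suc i"] unfolding r_def by (intro mult_left_mono) auto
  finally show ?case
    by (simp add: algebra_simps del: round_start.simps)
qed

end

section \<open>The sequence of evasiveness values\<close>

lemma u_seq_0: "u_seq 0 = 4"
  by (simp add: u_seq_def)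

lemma mono_u_seq: "mono u_seq"
proof (rule monoI)
  fix i j :: nat assume "i \<le> j"
  then have "(2::real) ^ i * sqrt (real i + 1) \<le> 2 ^ j * sqrt (real j + 1)"
    by (intro mult_mono power_increasing) auto
  then show "u_seq i \<le> u_seq j"
    by (simp add: u_seq_def)
qed

text \<open>Crude, but enough to make the sequence unbounded, so that every \<open>u\<close> is at
  most some \<open>u_seq n\<close>.\<close>

lemma u_seq_ge_power: "2 ^ i \<le> u_seq i"
proof -
  have "real i + 1 \<le> 2 ^ i"
    using less_exp[of i] by (metis Suc_leI of_nat_Suc of_nat_le_iff of_nat_numeral of_nat_power
        add.commute)
  also have "\<dots> * 1 \<le> 2 ^ i * sqrt (real i + 1)"
    by (intro mult_left_mono) auto
  finally have "real i \<le> 3 * 2 ^ i * sqrt (real i + 1) - 1"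
    by simp
  then have "2 powr real i \<le> u_seq i"
    by (simp add: u_seq_def)
  then show ?thesis
    by (simp add: powr_realpow)
qed

lemma u_seq_ge_1: "u_seq i \<ge> 1"
  using u_seq_ge_power[of i] one_le_power[of "2::real" i] by linarith

text \<open>The \<open>- 1\<close> in the exponent of \<open>u_seq\<close> cancels each factor
  2.\<close>

lemma prod_u_seq:
  "(\<Prod>j=1..i. 2 * u_seq j) = 2 powr (\<Sum>j=1..i. 3 * 2 ^ j * sqrt (real j + 1))"
proof -
  have "2 * u_seq j = 2 powr (3 * 2 ^ j * sqrt (real j + 1))" for j
    by (simp add: u_seq_def powr_diff)
  then show ?thesis
    by (simp add: powr_sum)
qed

text \<open>From 4 on, \<open>log 2 (log 2 u) \<ge> 1\<close>, so the exponent is positive and grows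
  along with the base.\<close>

lemma powr_rate_mono:
  fixes u w :: real
  assumes "4 \<le> u" "u \<le> w"
  shows "u powr (4 - 1 / (log 2 (log 2 u))\<^sup>2) \<le> w powr (4 - 1 / (log 2 (log 2 w))\<^sup>2)"
proof -
  have L: "2 \<le> log 2 u" "log 2 u \<le> log 2 w"
    using assms by (simp_all add: le_log_iff powr_numeral)
  then have l: "1 \<le> log 2 (log 2 u)" "log 2 (log 2 u) \<le> log 2 (log 2 w)"
    by (simp_all add: le_log_iff)
  have "u powr (4 - 1 / (log 2 (log 2 u))\<^sup>2) \<le> u powr (4 - 1 / (log 2 (log 2 w))\<^sup>2)"
    using assms l by (intro powr_mono diff_left_mono divide_left_mono power_mono mult_pos_pos
        zero_less_power) linarith+
  also have "\<dots> \<le> w powr (4 - 1 / (log 2 (log 2 w))\<^sup>2)"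
  proof (rule powr_mono2)
    have "1 \<le> (log 2 (log 2 w))\<^sup>2"
      using l by (intro one_le_power) simp
    then have "1 / (log 2 (log 2 w))\<^sup>2 \<le> 1"
      by (intro divide_le_eq_1_pos[THEN iffD2]) linarith+
    then show "0 \<le> 4 - 1 / (log 2 (log 2 w))\<^sup>2"
      by linarith
  qed (use assms in auto)
  finally show ?thesis .
qed

section \<open>Comparison of exponents\<close>

text \<open>Quantitative concavity of the square root. The product of the two roots on the left is
  at most \<open>n - 1 / (2 * n)\<close>, whose square exceeds \<open>n\<^sup>2 - 1\<close> by
  \<open>1 / (4 * n\<^sup>2)\<close>.\<close>

lemma sqrt_add_sqrt_le:
  fixes n :: real
  assumes "n \<ge> 1"
  shows "sqrt (n - 1) + sqrt (n + 1) \<le> 2 * sqrt n - 1 / (4 * n * sqrt n)"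
proof -
  define a b where "a = sqrt (n - 1)" and "b = sqrt (n + 1)"
  define s where "s = sqrt n"
  have s: "s \<ge> 1" "s\<^sup>2 = n"
    using assms by (simp_all add: s_def)
  have ab: "a\<^sup>2 = n - 1" "b\<^sup>2 = n + 1" "a * b = sqrt (n\<^sup>2 - 1)"
    using assms by (simp_all add: a_def b_def real_sqrt_mult[symmetric] power2_eq_square algebra_simps)
  have "a * b \<le> n - 1 / (2 * n)"
    unfolding ab(3)
  proof (rule real_le_lsqrt)
    have "1 / (2 * n) \<le> 1" 
      using assms by simp
    then show "0 \<le> n - 1 / (2 * n)" 
      using assms by linarith
    show "n\<^sup>2 - 1 \<le> (n - 1 / (2 * n))\<^sup>2"
      using assms by (simp add: power2_diff)
  qed
  then have "(a + b)\<^sup>2 \<le> 4 * n - 1 / n"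
    using ab(1,2) by (simp add: power2_sum)
  also have "\<dots> \<le> (2 * s - 1 / (4 * n * s))\<^sup>2"
    using s by (simp add: power2_diff power_mult_distrib)
  finally have "(a + b)\<^sup>2 \<le> (2 * s - 1 / (4 * n * s))\<^sup>2" .
  moreover have "1 * 1 \<le> n * s"
    using assms s by (intro mult_mono) auto
  then have "1 / (4 * n * s) \<le> 1"
    by simp
  then have "0 \<le> 2 * s - 1 / (4 * n * s)"
    using s by linarith
  ultimately show ?thesis
    unfolding a_def b_def s_def by (rule power2_le_imp_le)
qed

text \<open>The induction starts at 2 because the inequality fails at \<open>i = 1\<close>.\<close>

lemma exponent_sum_le:
  assumes "i \<ge> 2"
  shows "(\<Sum>j=1..i. 3 * 2 ^ j * sqrt (real j + 1)) + 3 / 2 * 2 ^ i / (real i * sqrt (real i))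
           \<le> 6 * 2 ^ i * sqrt (real i) - 2"
  using assms
proof (induction i rule: nat_induct_at_least)
  case base
  \<comment> \<open>Multiplied by \<open>sqrt 2\<close>, the base case reads
    \<open>15 + 12 * sqrt 6 + 2 * sqrt 2 \<le> 48\<close>.\<close>
  have "sqrt 2 \<le> 1.415" "sqrt 6 \<le> 2.45"
    by (rule real_le_lsqrt; simp add: power2_eq_square)+
  moreover have "sqrt 2 * sqrt 3 = sqrt 6"
    by (simp flip: real_sqrt_mult)
  ultimately have "sqrt 2 \<le> 1.415" "sqrt 2 * sqrt 3 \<le> 2.45"
    by simp_all
  then show ?case
    by (simp add: numeral_2_eq_2 field_simps)
next
  case (Suc i)
  define x where "x = real i"
  have x: "x \<ge> 1"
    using Suc by (simp add: x_def)
  define p q where "p = 1 / ((x + 1) * sqrt (x + 1))" and "q = 1 / (x * sqrt x)"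
  have "p \<le> q"
    unfolding p_def q_def using x by (intro divide_left_mono mult_mono) auto
  moreover have "sqrt x + sqrt (x + 2) \<le> 2 * sqrt (x + 1) - p / 4"
    using sqrt_add_sqrt_le[of "x + 1"] x by (simp add: p_def algebra_simps)
  \<comment> \<open>From \<open>p \<le> q\<close> follows \<open>2 * p - q \<le> p\<close>; the 2 on
    the left comes from \<open>2 ^ Suc i\<close>.\<close>
  ultimately have step: "2 * p - q \<le> 4 * (2 * sqrt (x + 1) - sqrt x - sqrt (x + 2))"
    by argo
  have "3 / 2 * 2 ^ i * (2 * p - q)
      \<le> 3 / 2 * 2 ^ i * (4 * (2 * sqrt (x + 1) - sqrt x - sqrt (x + 2)))"
    by (intro mult_left_mono step) simp
  then show ?case
    using Suc.IH by (simp add: x_def p_def q_def algebra_simps)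
qed

lemma log_u_seq: "log 2 (u_seq i) = 3 * 2 ^ i * sqrt (real i + 1) - 1"
  by (simp add: u_seq_def)

lemma power_le_log_u_seq: "2 ^ Suc i \<le> log 2 (u_seq i)"
proof -
  have "(2::real) ^ i * 1 \<le> 2 ^ i * sqrt (real i + 1)"
    by (intro mult_left_mono) auto
  moreover have "(1::real) \<le> 2 ^ i"
    by simp
  ultimately show ?thesis
    unfolding log_u_seq power_Suc by linarith
qed

text \<open>The left side is what the correction to the power 4 costs in the exponent; the right
  side is the extra summand of \<open>exponent_sum_le\<close> at \<open>Suc i\<close>.\<close>

lemma log_u_seq_over_loglog_le:
  "log 2 (u_seq i) / (log 2 (log 2 (u_seq i)))\<^sup>2
     \<le> 3 / 2 * 2 ^ Suc i / (real (Suc i) * sqrt (real (Suc i)))"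
proof -
  define L where "L = log 2 (u_seq i)"
  define x where "x = real (Suc i)"
  have x: "x \<ge> 1"
    by (simp add: x_def)
  have L: "2 ^ Suc i \<le> L"
    using power_le_log_u_seq by (simp add: L_def)
  moreover have "(0::real) < 2 ^ Suc i"
    by simp
  ultimately have L_pos: "L > 0"
    by linarith
  have "2 powr x \<le> L"
    unfolding x_def using L by (subst powr_realpow) auto
  then have "x \<le> log 2 L"
    using L_pos by (simp add: le_log_iff)
  then have "L / (log 2 L)\<^sup>2 \<le> L / x\<^sup>2"
    using x L_pos by (intro divide_left_mono power_mono mult_pos_pos zero_less_power) linarith+
  also have "\<dots> \<le> (3 * 2 ^ i * sqrt x) / x\<^sup>2"
    by (intro divide_right_mono) (auto simp: L_def log_u_seq x_def add.commute)
  also have "\<dots> = 3 * 2 ^ i / (x * sqrt x)"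
  proof -
    have "sqrt x / x\<^sup>2 = 1 / (x * sqrt x)"
      using x by (subst frac_eq_eq) (auto simp: power2_eq_square)
    then show ?thesis
      by (metis times_divide_eq_right mult.right_neutral)
  qed
  finally show ?thesis
    by (simp add: L_def x_def)
qed

text \<open>For \<open>k = 0\<close> the exponent on the right is 3, and
  \<open>9 * 2 powr (6 * sqrt 2)\<close> is compared with \<open>56.18 * 64\<close>. For larger
  \<open>k\<close> the factor 36 suffices.\<close>

lemma prod_u_seq_le:
  "9 * (\<Prod>j=1..Suc k. 2 * u_seq j)
     \<le> 56.18 * u_seq k powr (4 - 1 / (log 2 (log 2 (u_seq k)))\<^sup>2)"
proof (cases "k = 0")
  case True
  have log4: "log 2 4 = (2::real)"
    using log_u_seq[of 0] by (simp add: u_seq_0)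
  have sqrt2: "sqrt 2 \<le> 1.415"
    by (rule real_le_lsqrt) (simp_all add: power2_eq_square)
  have "2 powr (6 * sqrt 2) \<le> 2 powr (8 + 1 / 2)"
    using sqrt2 by (intro powr_mono) auto
  also have "\<dots> = 256 * sqrt 2"
    by (subst powr_add) (simp add: powr_half_sqrt)
  finally have "9 * 2 powr (6 * sqrt 2) \<le> 56.18 * 64"
    using sqrt2 by simp
  then show ?thesis
    using True prod_u_seq[of 1] by (simp add: u_seq_0 log4)
next
  case False
  define L where "L = log 2 (u_seq k)"
  define q where "q = L / (log 2 L)\<^sup>2"
  have "u_seq k = 2 powr L"
    using u_seq_ge_1[of k] by (simp add: L_def)
  then have rate: "u_seq k powr (4 - 1 / (log 2 L)\<^sup>2) = 2 powr (4 * L - q)"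
    by (simp add: powr_powr q_def algebra_simps)
  \<comment> \<open>The constant here is \<open>- 4\<close>, against \<open>- 2\<close> in
    \<open>exponent_sum_le\<close>; the excess 2 costs the factor 4 in 36.\<close>
  have "4 * L = 6 * 2 ^ Suc k * sqrt (real (Suc k)) - 4"
    by (simp add: L_def log_u_seq add.commute)
  then have "(\<Sum>j=1..Suc k. 3 * 2 ^ j * sqrt (real j + 1)) \<le> 2 + (4 * L - q)"
    using exponent_sum_le[of "Suc k"] log_u_seq_over_loglog_le[of k] False
    unfolding q_def L_def by linarith
  then have "9 * (\<Prod>j=1..Suc k. 2 * u_seq j) \<le> 9 * 2 powr (2 + (4 * L - q))"
    unfolding prod_u_seq by simp
  also have "\<dots> = 36 * 2 powr (4 * L - q)"
    by (subst powr_add) simp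
  also have "\<dots> \<le> 56.18 * 2 powr (4 * L - q)"
    by (intro mult_right_mono) auto
  finally show ?thesis
    using rate by (simp add: L_def)
qed

theorem theorem2:
  fixes d :: real
  assumes "d \<ge> 1"
  shows "(\<forall>u::real. 1 \<le> u \<and> u \<le> 4 \<longrightarrow> CR d (zigzag d u_seq) u = 9) \<and>
         (\<forall>u::real. u > 4 \<longrightarrow>
            CR d (zigzag d u_seq) u \<le> ereal (56.18 * u powr (4 - 1 / (log 2 (log 2 u))\<^sup>2)))"
proof -
  interpret zigzag_strategy d u_seq
    using assms u_seq_ge_1 by unfold_locales auto
  have "CR d (zigzag d u_seq) u = 9" if "1 \<le> u" "u \<le> 4" for u
    using CR_eq_first_rounds[of u] that monoD[OF mono_u_seq, of 0 1] by (simp add: u_seq_0)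
  moreover have "CR d (zigzag d u_seq) u \<le> ereal (56.18 * u powr (4 - 1 / (log 2 (log 2 u))\<^sup>2))"
    if u: "u > 4" for u
  proof -
    obtain n where "u < 2 ^ n"
      using real_arch_pow[of 2 u] by auto
    then have ex: "u \<le> u_seq n"
      using u_seq_ge_power[of n] by linarith
    define i where "i = (LEAST i. u \<le> u_seq i)"
    have i: "u \<le> u_seq i"
      unfolding i_def using ex by (rule LeastI)
    then have "i \<noteq> 0"
      using u u_seq_0 by (auto intro: ccontr)
    then obtain k where k: "i = Suc k"
      using not0_implies_Suc by blast
    have "u_seq k < u"
      using not_less_Least[of k "\<lambda>i. u \<le> u_seq i"] k i_def by simp
    \<comment> \<open>Round \<open>i\<close> may go to the wrong side, so the bound uses the start
      of round \<open>Suc i\<close>.\<close>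
    have "CR d (zigzag d u_seq) u \<le> ereal (1 + round_start d u_seq (Suc i) / d)"
      using u i monoD[OF mono_u_seq, of i "Suc i"] by (intro CR_le) auto
    also have "1 + round_start d u_seq (Suc i) / d \<le> 9 * (\<Prod>j=1..i. 2 * u_seq j)"
      using round_start_ratio_le[of i] by (simp add: u_seq_0 del: round_start.simps)
    also have "\<dots> \<le> 56.18 * u_seq k powr (4 - 1 / (log 2 (log 2 (u_seq k)))\<^sup>2)"
      unfolding k by (rule prod_u_seq_le)
    also have "\<dots> \<le> 56.18 * u powr (4 - 1 / (log 2 (log 2 u))\<^sup>2)"
      using \<open>u_seq k < u\<close> monoD[OF mono_u_seq, of 0 k]
      by (intro mult_left_mono powr_rate_mono) (auto simp: u_seq_0)
    finally show ?thesis
      by simp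
  qed
  ultimately show ?thesis
    by blast
qed

end
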